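(* There is a universal constant $K$ such that the following holds. Let $n,l\ge 1$ be integers, let $M\ge 0$, let $\Theta:=\{\theta\in\mathbb{R}^l:\Vert\theta\Vert_1\leq M\}$, let $\mathfrak{X}$ be an arbitrary set, let $\{\phi_\theta:\mathfrak{X}\to\mathbb{R}:\theta\in\Theta\}$ be a family of functions, and let $x=(x_1,\dots,x_n)\in\mathfrak{X}^n$ be fixed. If $A:\mathfrak{X}^n\to\mathbb{R}$ is a function fulfilling $$d(\theta,\theta')\leq\sqrt{n}\,A(x)\,\Vert\theta-\theta'\Vert_2\quad\text{for all }\theta,\theta'\in\Theta,$$ then for arbitrary $\theta_0\in\Theta$ $$\mathbb{E}\sup_{\theta\in\Theta}|X_\theta(x)|\leq \mathbb{E}|X_{\theta_0}(x)|+ K\sqrt{n\log(l+1)}\,\log(n+1)\,A(x)\,M.$$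
   Context: $\epsilon_1,\dots,\epsilon_n$ are i.i.d. Rademacher random variables (each equal to $+1$ or $-1$ with probability $1/2$), and $X_\theta(x):=\sum_{i=1}^n\epsilon_i\phi_\theta(x_i)$. The pseudometric $d$ on $\Theta$ is $d(\theta,\theta'):=\Vert(\phi_\theta(x_1)-\phi_{\theta'}(x_1),\dots,\phi_\theta(x_n)-\phi_{\theta'}(x_n))^T\Vert_2$; it depends on $x$. "Universal constant" means $K$ does not depend on $n,l,M,\mathfrak{X},x$, the functions $\phi_\theta$, $A$ or $\theta_0$. *)

theory Defs
  imports "HOL-Probability.Probability"
begin

text \<open>
  The dimensions \<open>l\<close> and \<open>n\<close> are bound variables of the result (the constant must not depend on
  them), so \<open>\<real>\<^sup>l\<close> is the carrier of the library's \<^const>\<open>Euclidean_space\<close>, i.e. the sequences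
  supported on \<open>{..<l}\<close>, and points of \<open>\<XX>\<^sup>n\<close> are elements of \<open>{..<n} \<rightarrow>\<^sub>E \<XX>\<close>.
  Indices run over \<open>0, \<dots>, n - 1\<close> instead of \<open>1, \<dots>, n\<close>.
\<close>

definition l1_ball :: "nat \<Rightarrow> real \<Rightarrow> (nat \<Rightarrow> real) set" where
  "l1_ball l M = {\<theta> \<in> topspace (Euclidean_space l). (\<Sum>j<l. \<bar>\<theta> j\<bar>) \<le> M}"

text \<open>The joint law of \<open>n\<close> i.i.d. Rademacher variables; the components from \<open>n\<close> on are \<open>0\<close>.\<close>

definition rademacher_pmf :: "nat \<Rightarrow> (nat \<Rightarrow> real) pmf" where
  "rademacher_pmf n = Pi_pmf {..<n} 0 (\<lambda>_. pmf_of_set {-1, 1})"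

definition rademacher_sum ::
    "nat \<Rightarrow> ((nat \<Rightarrow> real) \<Rightarrow> 'a \<Rightarrow> real) \<Rightarrow> (nat \<Rightarrow> 'a) \<Rightarrow> (nat \<Rightarrow> real) \<Rightarrow> (nat \<Rightarrow> real) \<Rightarrow> real" where
  "rademacher_sum n \<phi> x \<theta> \<epsilon> = (\<Sum>i<n. \<epsilon> i * \<phi> \<theta> (x i))"

definition param_dist ::
    "nat \<Rightarrow> ((nat \<Rightarrow> real) \<Rightarrow> 'a \<Rightarrow> real) \<Rightarrow> (nat \<Rightarrow> 'a) \<Rightarrow> (nat \<Rightarrow> real) \<Rightarrow> (nat \<Rightarrow> real) \<Rightarrow> real" where
  "param_dist n \<phi> x \<theta> \<theta>' = L2_set (\<lambda>i. \<phi> \<theta> (x i) - \<phi> \<theta>' (x i)) {..<n}"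

definition rademacher_sup_bound :: "real \<Rightarrow> 'a set \<Rightarrow> bool" where
  "rademacher_sup_bound K \<XX> \<longleftrightarrow>
    (\<forall>n l M. \<forall>\<phi> :: (nat \<Rightarrow> real) \<Rightarrow> 'a \<Rightarrow> real. \<forall>x A \<theta>0.
      1 \<le> n \<longrightarrow> 1 \<le> l \<longrightarrow> 0 \<le> M \<longrightarrow> x \<in> {..<n} \<rightarrow>\<^sub>E \<XX> \<longrightarrow>
      (\<forall>\<theta>\<in>l1_ball l M. \<forall>\<theta>'\<in>l1_ball l M.
        param_dist n \<phi> x \<theta> \<theta>' \<le> sqrt (real n) * A x * L2_set (\<lambda>j. \<theta> j - \<theta>' j) {..<l}) \<longrightarrow>
      \<theta>0 \<in> l1_ball l M \<longrightarrow>
      measure_pmf.expectation (rademacher_pmf n)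
          (\<lambda>\<epsilon>. SUP \<theta>\<in>l1_ball l M. \<bar>rademacher_sum n \<phi> x \<theta> \<epsilon>\<bar>)
        \<le> measure_pmf.expectation (rademacher_pmf n) (\<lambda>\<epsilon>. \<bar>rademacher_sum n \<phi> x \<theta>0 \<epsilon>\<bar>)
          + K * sqrt (real n * ln (real l + 1)) * ln (real n + 1) * A x * M)"

text \<open>
  The constant may not depend on \<open>\<XX>\<close>, hence not on the type in which \<open>\<XX>\<close> lives. A statement
  \<open>\<exists>K. \<forall>\<XX> :: 'a set. \<dots>\<close> would let \<open>K\<close> depend on \<open>'a\<close>, as HOL does not quantify over types inside
  a formula. A closed term of type \<^typ>\<open>real\<close> cannot depend on \<open>'a\<close>. It is chosen here
  by its property for sets of natural numbers, which by the lemma below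
  already implies the property for sets over every type: so some \<open>K\<close> serves all sets over all
  types if and only if this one does.
\<close>

definition universal_K :: real where
  "universal_K = (SOME K. \<forall>\<XX> :: nat set. rademacher_sup_bound K \<XX>)"

lemma rademacher_sup_bound_transfer:
  fixes \<XX> :: "'a set"
  assumes K: "\<forall>\<YY> :: nat set. rademacher_sup_bound K \<YY>"
  shows "rademacher_sup_bound K \<XX>"
  unfolding rademacher_sup_bound_def
proof (intro allI impI)
  fix n l :: nat and M :: real and \<phi> :: "(nat \<Rightarrow> real) \<Rightarrow> 'a \<Rightarrow> real"
    and x :: "nat \<Rightarrow> 'a" and A :: "(nat \<Rightarrow> 'a) \<Rightarrow> real" and \<theta>0 :: "nat \<Rightarrow> real"
  assume nl: "1 \<le> n" "1 \<le> l" "0 \<le> M" and \<theta>0: "\<theta>0 \<in> l1_ball l M"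
    and lip: "\<forall>\<theta>\<in>l1_ball l M. \<forall>\<theta>'\<in>l1_ball l M.
        param_dist n \<phi> x \<theta> \<theta>' \<le> sqrt (real n) * A x * L2_set (\<lambda>j. \<theta> j - \<theta>' j) {..<l}"
  define \<psi> where "\<psi> = (\<lambda>\<theta> i. \<phi> \<theta> (x i))"
  define y where "y = restrict (\<lambda>i. i) {..<n}"
  have sum: "rademacher_sum n \<psi> y = rademacher_sum n \<phi> x"
    by (intro ext) (simp add: rademacher_sum_def \<psi>_def y_def)
  have dist: "param_dist n \<psi> y = param_dist n \<phi> x"
    by (intro ext) (auto simp: param_dist_def \<psi>_def y_def intro!: L2_set_cong)
  have y: "y \<in> {..<n} \<rightarrow>\<^sub>E (UNIV :: nat set)"
    by (simp add: y_def)
  have "rademacher_sup_bound K (UNIV :: nat set)"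
    using K by blast
  from this[unfolded rademacher_sup_bound_def, rule_format, of n l M y \<psi> "\<lambda>_. A x" \<theta>0,
      OF nl y _ \<theta>0] lip
  show "measure_pmf.expectation (rademacher_pmf n)
          (\<lambda>\<epsilon>. SUP \<theta>\<in>l1_ball l M. \<bar>rademacher_sum n \<phi> x \<theta> \<epsilon>\<bar>)
        \<le> measure_pmf.expectation (rademacher_pmf n) (\<lambda>\<epsilon>. \<bar>rademacher_sum n \<phi> x \<theta>0 \<epsilon>\<bar>)
          + K * sqrt (real n * ln (real l + 1)) * ln (real n + 1) * A x * M"
    unfolding sum dist by blast
qed

end

theory Submission
  imports Defs
begin

text \<open>
  The proof is Dudley's chaining with dyadic scales, stopped after about \<open>log\<^sub>4 n\<close> steps. It has
  three ingredients.

  First, a weighted Rademacher sum is subgaussian with variance proxy the squared Euclidean norm of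
  its weights, so the maximum of \<open>N\<close> such sums with weights of norm at most \<open>\<sigma>\<close> has expectation
  of order at most \<open>\<sigma> * sqrt (ln N)\<close> (lemma \<open>expectation_Max_le\<close>).

  Second, Maurey's empirical method: every point of the \<open>\<ell>\<^sub>1\<close> ball of radius \<open>M\<close> is approximated
  in Euclidean distance up to \<open>M / sqrt m\<close> by the average of \<open>m\<close> of the \<open>2 * l + 1\<close> points
  \<open>0\<close> and \<open>\<plusminus> M\<close> times a unit vector (lemma \<open>maurey_net_approx\<close>).
  Hence at most \<open>(2 * l + 1) ^ m\<close> points, all lying in the ball, form a net at scale \<open>M / sqrt m\<close>.

  With \<open>m = 4 ^ k\<close> the net at scale \<open>M / 2 ^ k\<close> has a logarithmic size of order
  \<open>4 ^ k * ln (l + 1)\<close>. The Lipschitz condition turns the scale into \<open>\<sigma>\<close> of order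
  \<open>sqrt n * A x * M / 2 ^ k\<close>, and the two powers of \<open>2\<close> cancel: each link of the chain
  costs the same multiple of \<open>sqrt (n * ln (l + 1)) * A x * M\<close>, whatever \<open>k\<close>
  is. The Cauchy--Schwarz inequality bounds every increment over a distance \<open>r\<close> in parameter
  space by \<open>n * A x * r\<close>, so that the chain may stop at scale \<open>M / sqrt n\<close>. The number of
  links is therefore of order \<open>ln (n + 1)\<close>, the second logarithmic factor of the bound.
\<close>

section \<open>Rademacher sums\<close>

lemma set_rademacher_pmf:
  "set_pmf (rademacher_pmf n) = PiE_dflt {..<n} 0 (\<lambda>_. {-1, 1})"
  unfolding rademacher_pmf_def by (subst set_Pi_pmf) (auto simp: PiE_dflt_def)

lemma integrable_rademacher [simp]:
  fixes f :: "(nat \<Rightarrow> real) \<Rightarrow> real"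
  shows "integrable (measure_pmf (rademacher_pmf n)) f"
  by (rule integrable_measure_pmf_finite) (simp add: set_rademacher_pmf finite_PiE_dflt)

text \<open>
  With \<open>p = 1/2\<close> and \<open>h = 2 * x\<close> the function in the auxiliary inequality for Hoeffding's lemma
  is \<open>ln (cosh x)\<close>.
\<close>

lemma cosh_le_exp_half_square: "cosh x \<le> exp (x\<^sup>2 / 2)" for x :: real
proof -
  have *: "cosh y \<le> exp (y\<^sup>2 / 2)" if "y \<ge> 0" for y :: real
  proof -
    have "- (2 * y) * (1/2) + ln (1 + 1/2 * (exp (2 * y) - 1)) \<le> (2 * y)\<^sup>2 / 8"
      using that by (intro Hoeffdings_lemma_aux) auto
    moreover have "1 + 1/2 * (exp (2 * y) - 1) = exp y * cosh y"
      by (simp add: cosh_def exp_minus field_simps flip: exp_add)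
    ultimately have "ln (cosh y) \<le> y\<^sup>2 / 2"
      by (simp add: ln_mult power2_eq_square)
    then show ?thesis
      by (metis cosh_real_pos exp_le_cancel_iff exp_ln)
  qed
  show ?thesis
    using *[of x] *[of "- x"] by (cases "x \<ge> 0") auto
qed

text \<open>
  By independence the moment generating function is the product of the factors \<open>cosh (t * a i)\<close>.
\<close>

lemma rademacher_mgf_le:
  "measure_pmf.expectation (rademacher_pmf n) (\<lambda>\<epsilon>. exp (t * (\<Sum>i<n. \<epsilon> i * a i)))
    \<le> exp ((t * L2_set a {..<n})\<^sup>2 / 2)"
proof -
  have "measure_pmf.expectation (rademacher_pmf n) (\<lambda>\<epsilon>. exp (t * (\<Sum>i<n. \<epsilon> i * a i)))
      = measure_pmf.expectation (rademacher_pmf n) (\<lambda>\<epsilon>. \<Prod>i<n. exp (t * a i * \<epsilon> i))"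
    by (simp add: sum_distrib_left exp_sum mult_ac)
  also have "\<dots> = (\<Prod>i<n. measure_pmf.expectation (pmf_of_set {-1, 1}) (\<lambda>v. exp (t * a i * v)))"
    unfolding rademacher_pmf_def
    by (intro expectation_prod_Pi_pmf integrable_measure_pmf_finite) auto
  also have "\<dots> = (\<Prod>i<n. cosh (t * a i))"
    by (simp add: integral_pmf_of_set cosh_def add.commute)
  also have "\<dots> \<le> (\<Prod>i<n. exp ((t * a i)\<^sup>2 / 2))"
    by (intro prod_mono conjI cosh_le_exp_half_square) simp
  also have "\<dots> = exp ((t * L2_set a {..<n})\<^sup>2 / 2)"
    by (simp add: L2_set_def power_mult_distrib sum_nonneg sum_distrib_left sum_divide_distrib
        flip: exp_sum)
  finally show ?thesis .
qed

text \<open>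
  For \<open>t > 0\<close> the exponential of \<open>t\<close> times the maximum is at most the sum of the exponentials of
  all \<open>\<plusminus> t * Y j\<close>, whose expectation is at most \<open>2 * N * exp ((t * \<sigma>)\<^sup>2 / 2)\<close>. Taking
  logarithms leaves two terms, which are of the same order for \<open>t = sqrt (ln (2 * N)) / \<sigma>\<close>.
\<close>

lemma expectation_Max_le:
  fixes a :: "'j \<Rightarrow> nat \<Rightarrow> real"
  assumes J: "finite J" "J \<noteq> {}" "card J \<le> N"
    and \<sigma>: "\<And>j. j \<in> J \<Longrightarrow> L2_set (a j) {..<n} \<le> \<sigma>"
  shows "measure_pmf.expectation (rademacher_pmf n) (\<lambda>\<epsilon>. MAX j\<in>J. \<bar>\<Sum>i<n. \<epsilon> i * a j i\<bar>)
    \<le> 3 / 2 * \<sigma> * sqrt (ln (2 * real N))"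
proof (cases "\<sigma> = 0")
  case True
  then have "a j i = 0" if "j \<in> J" "i < n" for i j
    using \<sigma>[OF that(1)] L2_set_nonneg[of "a j" "{..<n}"] L2_set_eq_0_iff[of "{..<n}" "a j"] that(2)
    by simp
  then have "(\<lambda>j. \<bar>\<Sum>i<n. \<epsilon> i * a j i\<bar>) ` J = {0}" for \<epsilon> :: "nat \<Rightarrow> real"
    using J(2) by (auto simp: image_iff)
  then show ?thesis
    using True by simp
next
  case False
  define Y where "Y = (\<lambda>j (\<epsilon> :: nat \<Rightarrow> real). \<Sum>i<n. \<epsilon> i * a j i)"
  obtain j0 where "j0 \<in> J"
    using J(2) by blast
  then have \<sigma>_pos: "\<sigma> > 0"
    using False \<sigma>[of j0] L2_set_nonneg[of "a j0" "{..<n}"] by linarith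
  have "card J \<ge> 1"
    using J by (simp add: Suc_leI card_gt_0_iff)
  then have N: "real N \<ge> 1"
    using J(3) by linarith
  define q where "q = sqrt (ln (2 * real N))"
  have q: "q > 0" "q\<^sup>2 = ln (2 * real N)"
    unfolding q_def using N by (auto simp: ln_ge_zero)
  define t where "t = q / \<sigma>"
  have t: "t > 0" "t * \<sigma> = q"
    unfolding t_def using q \<sigma>_pos by auto
  define c where "c = 3 / 2 * q\<^sup>2"
  have mgf: "measure_pmf.expectation (rademacher_pmf n) (\<lambda>\<epsilon>. exp (u * Y j \<epsilon>)) \<le> exp (q\<^sup>2 / 2)"
    if "j \<in> J" "u = t \<or> u = - t" for j u
  proof -
    have "measure_pmf.expectation (rademacher_pmf n) (\<lambda>\<epsilon>. exp (u * Y j \<epsilon>))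
        \<le> exp ((u * L2_set (a j) {..<n})\<^sup>2 / 2)"
      unfolding Y_def by (rule rademacher_mgf_le)
    also have "(u * L2_set (a j) {..<n})\<^sup>2 = (t * L2_set (a j) {..<n})\<^sup>2"
      using that(2) by (auto simp: power_mult_distrib)
    also have "\<dots> \<le> (t * \<sigma>)\<^sup>2"
      using \<sigma>[OF that(1)] t(1) by (intro power_mono mult_left_mono) auto
    finally show ?thesis
      using t(2) by simp
  qed
  \<comment> \<open>The tangent bound \<open>z \<le> exp (z - c) + c - 1\<close> takes the place of Jensen's inequality. The value
      of \<open>c\<close> is the logarithm of the bound on the expected sum of exponentials.\<close>
  have pointwise: "t * (MAX j\<in>J. \<bar>Y j \<epsilon>\<bar>)
      \<le> exp (- c) * (\<Sum>j\<in>J. exp (t * Y j \<epsilon>) + exp (- t * Y j \<epsilon>)) + (c - 1)" for \<epsilon>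
  proof -
    have "(MAX j\<in>J. \<bar>Y j \<epsilon>\<bar>) \<in> (\<lambda>j. \<bar>Y j \<epsilon>\<bar>) ` J"
      using J by (intro Max_in) auto
    then obtain j where j: "j \<in> J" "(MAX j\<in>J. \<bar>Y j \<epsilon>\<bar>) = \<bar>Y j \<epsilon>\<bar>"
      by blast
    have "t * \<bar>Y j \<epsilon>\<bar> \<le> exp (t * \<bar>Y j \<epsilon>\<bar> - c) + (c - 1)"
      using exp_ge_add_one_self[of "t * \<bar>Y j \<epsilon>\<bar> - c"] by linarith
    also have "exp (t * \<bar>Y j \<epsilon>\<bar> - c) = exp (- c) * exp (t * \<bar>Y j \<epsilon>\<bar>)"
      by (simp flip: exp_add)
    also have "exp (t * \<bar>Y j \<epsilon>\<bar>) \<le> exp (t * Y j \<epsilon>) + exp (- t * Y j \<epsilon>)"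
      by (cases "Y j \<epsilon> \<ge> 0") auto
    also have "\<dots> \<le> (\<Sum>j\<in>J. exp (t * Y j \<epsilon>) + exp (- t * Y j \<epsilon>))"
      using j(1) J(1) by (intro member_le_sum[of j J "\<lambda>j. exp (t * Y j \<epsilon>) + exp (- t * Y j \<epsilon>)"]) auto
    finally show ?thesis
      using j(2) by simp
  qed
  have "t * measure_pmf.expectation (rademacher_pmf n) (\<lambda>\<epsilon>. MAX j\<in>J. \<bar>Y j \<epsilon>\<bar>)
      = measure_pmf.expectation (rademacher_pmf n) (\<lambda>\<epsilon>. t * (MAX j\<in>J. \<bar>Y j \<epsilon>\<bar>))"
    by simp
  also have "\<dots> \<le> measure_pmf.expectation (rademacher_pmf n)
      (\<lambda>\<epsilon>. exp (- c) * (\<Sum>j\<in>J. exp (t * Y j \<epsilon>) + exp (- t * Y j \<epsilon>)) + (c - 1))"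
    by (intro integral_mono pointwise) simp_all
  also have "\<dots> = exp (- c) * (\<Sum>j\<in>J.
        measure_pmf.expectation (rademacher_pmf n) (\<lambda>\<epsilon>. exp (t * Y j \<epsilon>))
      + measure_pmf.expectation (rademacher_pmf n) (\<lambda>\<epsilon>. exp (- t * Y j \<epsilon>))) + (c - 1)"
    by (simp add: Bochner_Integration.integral_add Bochner_Integration.integral_sum)
  also have "\<dots> \<le> exp (- c) * (\<Sum>j\<in>J. exp (q\<^sup>2 / 2) + exp (q\<^sup>2 / 2)) + (c - 1)"
    by (intro add_mono mult_left_mono sum_mono mgf) auto
  also have "\<dots> = exp (- c) * (2 * real (card J) * exp (q\<^sup>2 / 2)) + (c - 1)"
    by simp
  also have "\<dots> \<le> exp (- c) * (2 * real N * exp (q\<^sup>2 / 2)) + (c - 1)"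
    using J(3) by (intro add_mono mult_left_mono mult_right_mono) auto
  also have "2 * real N = exp (q\<^sup>2)"
    using N by (simp add: q(2))
  also have "exp (- c) * (exp (q\<^sup>2) * exp (q\<^sup>2 / 2)) = 1"
    by (simp add: c_def flip: exp_add)
  finally have "t * measure_pmf.expectation (rademacher_pmf n) (\<lambda>\<epsilon>. MAX j\<in>J. \<bar>Y j \<epsilon>\<bar>) \<le> c"
    by simp
  also have "c = t * (3 / 2 * \<sigma> * q)"
    using t(2) by (simp add: c_def power2_eq_square)
  finally show ?thesis
    using t(1) by (simp add: Y_def q_def)
qed

section \<open>Nets of the cross-polytope\<close>

lemma mem_l1_ball:
  "\<theta> \<in> l1_ball l M \<longleftrightarrow> (\<forall>i\<ge>l. \<theta> i = 0) \<and> (\<Sum>j<l. \<bar>\<theta> j\<bar>) \<le> M"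
  by (auto simp: l1_ball_def topspace_Euclidean_space)

text \<open>
  The origin is included so that the whole ball, and not just its boundary, consists of
  weighted means with weights \<open>\<bar>\<theta> j\<bar> / M\<close> at the vertices and the rest at \<open>0\<close>.
\<close>

definition cross_vertices :: "nat \<Rightarrow> real \<Rightarrow> (nat \<Rightarrow> real) set" where
  "cross_vertices l M =
    insert (\<lambda>_. 0) ((\<lambda>(j, c) i. if i = j then c else 0) ` ({..<l} \<times> {M, - M}))"

fun vertex_sums :: "nat \<Rightarrow> real \<Rightarrow> nat \<Rightarrow> (nat \<Rightarrow> real) set" where
  "vertex_sums l M 0 = {\<lambda>_. 0}"
| "vertex_sums l M (Suc m) =
    (\<lambda>(s, v) i. s i + v i) ` (vertex_sums l M m \<times> cross_vertices l M)"

definition maurey_net :: "nat \<Rightarrow> real \<Rightarrow> nat \<Rightarrow> (nat \<Rightarrow> real) set" where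
  "maurey_net l M m = (\<lambda>s i. s i / real m) ` vertex_sums l M m"

lemma card_cross_vertices: "finite (cross_vertices l M)" "card (cross_vertices l M) \<le> 2 * l + 1"
proof -
  let ?f = "\<lambda>(j, c) i. if i = j then c else (0::real)"
  have "card (?f ` ({..<l} \<times> {M, - M})) \<le> card ({..<l} \<times> {M, - M})"
    by (intro card_image_le) auto
  also have "\<dots> \<le> l * 2"
    by (auto simp: card_cartesian_product card_insert_if)
  finally have "card (?f ` ({..<l} \<times> {M, - M})) \<le> 2 * l + 1 - 1"
    by simp
  then show "card (cross_vertices l M) \<le> 2 * l + 1"
    unfolding cross_vertices_def by (intro card_insert_le_m1) simp_all
qed (simp add: cross_vertices_def)

lemma card_vertex_sums: "finite (vertex_sums l M m) \<and> card (vertex_sums l M m) \<le> (2 * l + 1) ^ m"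
proof (induction m)
  case (Suc m)
  have "card (vertex_sums l M (Suc m)) \<le> card (vertex_sums l M m \<times> cross_vertices l M)"
    unfolding vertex_sums.simps using Suc card_cross_vertices by (intro card_image_le) auto
  also have "\<dots> \<le> (2 * l + 1) ^ m * (2 * l + 1)"
    unfolding card_cartesian_product using Suc card_cross_vertices by (intro mult_mono) auto
  finally show ?case
    using Suc card_cross_vertices by (simp add: mult.commute)
qed simp

lemma vertex_sums_subset_l1_ball:
  assumes "M \<ge> 0"
  shows "vertex_sums l M m \<subseteq> l1_ball l (real m * M)"
proof (induction m)
  case 0
  then show ?case
    by (simp add: mem_l1_ball)
next
  case (Suc m)
  have v: "(\<forall>i\<ge>l. v i = 0) \<and> (\<Sum>j<l. \<bar>v j\<bar>) \<le> M" if "v \<in> cross_vertices l M" for v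
    using that assms by (auto simp: cross_vertices_def if_distrib cong: if_cong)
  show ?case
  proof
    fix r assume "r \<in> vertex_sums l M (Suc m)"
    then obtain s v where sv: "s \<in> vertex_sums l M m" "v \<in> cross_vertices l M" "r = (\<lambda>i. s i + v i)"
      by auto
    have "(\<Sum>j<l. \<bar>s j + v j\<bar>) \<le> (\<Sum>j<l. \<bar>s j\<bar>) + (\<Sum>j<l. \<bar>v j\<bar>)"
      by (simp add: sum_mono flip: sum.distrib)
    with sv(1) v[OF sv(2)] Suc show "r \<in> l1_ball l (real (Suc m) * M)"
      by (auto simp: mem_l1_ball sv(3) algebra_simps)
  qed
qed

text \<open>
  Maurey's method draws \<open>v\<close> at random with mean \<open>\<theta>\<close>. The mean of
  \<open>\<bar>u + (v - \<theta>)\<bar>\<^sup>2\<close> is then \<open>\<bar>u\<bar>\<^sup>2\<close> plus the variance of \<open>v\<close>, which is at most \<open>M\<^sup>2\<close>, and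
  some \<open>v\<close> does no worse than the mean. The proof writes this mean, multiplied by \<open>M\<close> to avoid the
  division, as a finite sum: \<open>w j\<close> is the vertex on axis \<open>j\<close> on the side of \<open>\<theta>\<close>, with weight
  \<open>\<bar>\<theta> j\<bar>\<close>, and the origin has weight \<open>M - S\<close>.
\<close>

lemma cross_vertex_step:
  assumes \<theta>: "\<theta> \<in> l1_ball l M" and M: "M \<ge> 0"
  shows "\<exists>v\<in>cross_vertices l M. (\<Sum>j<l. (u j + (v j - \<theta> j))\<^sup>2) \<le> (\<Sum>j<l. (u j)\<^sup>2) + M\<^sup>2"
proof (rule ccontr)
  define F where "F = (\<lambda>v. \<Sum>i<l. (u i + (v i - \<theta> i))\<^sup>2)"
  define R where "R = (\<Sum>j<l. (u j)\<^sup>2) + M\<^sup>2"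
  define w where "w = (\<lambda>j i. if i = j then (if \<theta> j \<ge> 0 then M else - M) else 0)"
  define S where "S = (\<Sum>j<l. \<bar>\<theta> j\<bar>)"
  assume "\<not> ?thesis"
  then have gt: "F v > R" if "v \<in> cross_vertices l M" for v
    using that unfolding F_def R_def by force
  have S: "S \<le> M" "0 \<le> S"
    using \<theta> by (auto simp: mem_l1_ball S_def sum_nonneg)
  have F0: "F (\<lambda>_. 0) > R"
    by (rule gt) (simp add: cross_vertices_def)
  have Fw: "F (w j) > R" if "j < l" for j
    using that by (intro gt) (auto simp: cross_vertices_def w_def)
  have Fw_eq: "F (w j) = F (\<lambda>_. 0) + M\<^sup>2 + 2 * (w j j * (u j - \<theta> j))" if "j < l" for j
  proof -
    have "F (w j) = (\<Sum>i<l. (u i - \<theta> i)\<^sup>2 + (if i = j then M\<^sup>2 + 2 * (w j j * (u j - \<theta> j)) else 0))"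
      unfolding F_def by (intro sum.cong) (auto simp: w_def power2_eq_square algebra_simps)
    also have "\<dots> = (\<Sum>i<l. (u i - \<theta> i)\<^sup>2) + (M\<^sup>2 + 2 * (w j j * (u j - \<theta> j)))"
      using that by (simp add: sum.distrib)
    finally show ?thesis
      by (simp add: F_def)
  qed
  have abs_w: "\<bar>\<theta> j\<bar> * w j j = M * \<theta> j" for j
    by (simp add: w_def)
  have "(M - S) * (F (\<lambda>_. 0) - R) + (\<Sum>j<l. \<bar>\<theta> j\<bar> * (F (w j) - R))
      = (M - S) * (F (\<lambda>_. 0) - R)
        + (\<Sum>j<l. \<bar>\<theta> j\<bar> * (F (\<lambda>_. 0) - R + M\<^sup>2) + 2 * M * (\<theta> j * (u j - \<theta> j)))"
  proof (intro arg_cong2[where f = "(+)"] refl sum.cong)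
    fix j assume "j \<in> {..<l}"
    then have "\<bar>\<theta> j\<bar> * (F (w j) - R)
        = \<bar>\<theta> j\<bar> * (F (\<lambda>_. 0) - R + M\<^sup>2) + 2 * (\<bar>\<theta> j\<bar> * w j j) * (u j - \<theta> j)"
      by (simp add: Fw_eq algebra_simps)
    also have "2 * (\<bar>\<theta> j\<bar> * w j j) * (u j - \<theta> j) = 2 * M * (\<theta> j * (u j - \<theta> j))"
      by (simp only: abs_w mult.assoc)
    finally show "\<bar>\<theta> j\<bar> * (F (w j) - R)
        = \<bar>\<theta> j\<bar> * (F (\<lambda>_. 0) - R + M\<^sup>2) + 2 * M * (\<theta> j * (u j - \<theta> j))" .
  qed
  also have "\<dots> = M * (F (\<lambda>_. 0) - R) + S * M\<^sup>2 + M * (\<Sum>j<l. 2 * (\<theta> j * (u j - \<theta> j)))"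
  proof -
    have "(\<Sum>j<l. \<bar>\<theta> j\<bar> * (F (\<lambda>_. 0) - R + M\<^sup>2) + 2 * M * (\<theta> j * (u j - \<theta> j)))
        = S * (F (\<lambda>_. 0) - R + M\<^sup>2) + M * (\<Sum>j<l. 2 * (\<theta> j * (u j - \<theta> j)))"
      unfolding S_def sum_distrib_right sum_distrib_left sum.distrib[symmetric]
      by (intro sum.cong refl) simp
    then show ?thesis
      by (simp add: algebra_simps)
  qed
  also have "\<dots> = M * (F (\<lambda>_. 0) + (\<Sum>j<l. 2 * (\<theta> j * (u j - \<theta> j))) - R + S * M)"
    by (simp add: algebra_simps power2_eq_square)
  also have "F (\<lambda>_. 0) + (\<Sum>j<l. 2 * (\<theta> j * (u j - \<theta> j))) = (\<Sum>j<l. (u j)\<^sup>2 - (\<theta> j)\<^sup>2)"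
    unfolding F_def sum.distrib[symmetric]
    by (intro sum.cong) (auto simp: power2_eq_square algebra_simps)
  also have "\<dots> - R + S * M = S * M - M\<^sup>2 - (\<Sum>j<l. (\<theta> j)\<^sup>2)"
    by (simp add: R_def sum_subtractf)
  also have "M * \<dots> \<le> 0"
  proof (intro mult_nonneg_nonpos M)
    have "S * M \<le> M\<^sup>2"
      unfolding power2_eq_square using S(1) M by (rule mult_right_mono)
    then show "S * M - M\<^sup>2 - (\<Sum>j<l. (\<theta> j)\<^sup>2) \<le> 0"
      using sum_nonneg[of "{..<l}" "\<lambda>j. (\<theta> j)\<^sup>2"] by simp
  qed
  finally have le: "(M - S) * (F (\<lambda>_. 0) - R) + (\<Sum>j<l. \<bar>\<theta> j\<bar> * (F (w j) - R)) \<le> 0" .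
  \<comment> \<open>All terms are nonnegative, so every weight vanishes. The weights add up to \<open>M\<close>, so \<open>M = 0\<close>,
      and in that degenerate case the origin attains the bound.\<close>
  have nn: "0 \<le> (M - S) * (F (\<lambda>_. 0) - R)"
    using S(1) F0 by simp
  have nn': "0 \<le> (\<Sum>j<l. \<bar>\<theta> j\<bar> * (F (w j) - R))"
    using Fw by (intro sum_nonneg mult_nonneg_nonneg) (auto intro: less_imp_le)
  have "(\<Sum>j<l. \<bar>\<theta> j\<bar> * (F (w j) - R)) = 0" and "(M - S) * (F (\<lambda>_. 0) - R) = 0"
    using le nn nn' by linarith+
  then have "\<forall>j\<in>{..<l}. \<bar>\<theta> j\<bar> * (F (w j) - R) = 0" and MS: "M = S"
    using Fw F0 sum_nonneg_eq_0_iff[of "{..<l}" "\<lambda>j. \<bar>\<theta> j\<bar> * (F (w j) - R)"]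
    by (simp_all add: less_imp_le)
  then have "\<forall>j<l. \<theta> j = 0"
    using Fw by fastforce
  with MS have "M = 0" "F (\<lambda>_. 0) = (\<Sum>j<l. (u j)\<^sup>2)"
    by (auto simp: S_def F_def)
  with F0 show False
    by (simp add: R_def)
qed

text \<open>
  Choosing the vertices greedily, the squared error grows by at most \<open>M\<^sup>2\<close> per vertex, as it would
  on average for independent draws.
\<close>

lemma vertex_sums_approx:
  assumes "\<theta> \<in> l1_ball l M" "M \<ge> 0"
  shows "\<exists>s\<in>vertex_sums l M m. (\<Sum>j<l. (s j - real m * \<theta> j)\<^sup>2) \<le> real m * M\<^sup>2"
proof (induction m)
  case (Suc m)
  then obtain s where s: "s \<in> vertex_sums l M m" "(\<Sum>j<l. (s j - real m * \<theta> j)\<^sup>2) \<le> real m * M\<^sup>2"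
    by blast
  obtain v where v: "v \<in> cross_vertices l M"
    "(\<Sum>j<l. ((s j - real m * \<theta> j) + (v j - \<theta> j))\<^sup>2) \<le> (\<Sum>j<l. (s j - real m * \<theta> j)\<^sup>2) + M\<^sup>2"
    using cross_vertex_step[OF assms, of "\<lambda>j. s j - real m * \<theta> j"] by blast
  have "(\<lambda>i. s i + v i) \<in> vertex_sums l M (Suc m)"
    unfolding vertex_sums.simps using s(1) v(1)
    by (intro image_eqI[of _ _ "(s, v)"]) simp_all
  moreover have "(\<Sum>j<l. (s j + v j - real (Suc m) * \<theta> j)\<^sup>2) \<le> real (Suc m) * M\<^sup>2"
  proof -
    have "(\<Sum>j<l. (s j + v j - real (Suc m) * \<theta> j)\<^sup>2)
        = (\<Sum>j<l. ((s j - real m * \<theta> j) + (v j - \<theta> j))\<^sup>2)"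
      by (simp add: algebra_simps)
    also have "\<dots> \<le> real m * M\<^sup>2 + M\<^sup>2"
      using s(2) v(2) by linarith
    also have "\<dots> = real (Suc m) * M\<^sup>2"
      by (simp add: algebra_simps)
    finally show ?thesis .
  qed
  ultimately show ?case
    by (intro bexI[of _ "\<lambda>i. s i + v i"])
qed simp

lemma maurey_net_subset_l1_ball:
  assumes "M \<ge> 0" "m > 0"
  shows "maurey_net l M m \<subseteq> l1_ball l M"
proof
  fix t assume "t \<in> maurey_net l M m"
  then obtain s where s: "s \<in> vertex_sums l M m" "t = (\<lambda>i. s i / real m)"
    by (auto simp: maurey_net_def)
  then have "s \<in> l1_ball l (real m * M)"
    using vertex_sums_subset_l1_ball[OF assms(1)] by blast
  then show "t \<in> l1_ball l M"
    using assms(2) by (simp add: mem_l1_ball s(2) divide_le_eq mult.commute flip: sum_divide_distrib)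
qed

lemma card_maurey_net: "finite (maurey_net l M m)" "card (maurey_net l M m) \<le> (2 * l + 1) ^ m"
  unfolding maurey_net_def using card_vertex_sums[of l M m]
  by (auto intro: order.trans[OF card_image_le])

lemma maurey_net_approx:
  assumes "\<theta> \<in> l1_ball l M" "M \<ge> 0" "m > 0"
  shows "\<exists>s\<in>maurey_net l M m. L2_set (\<lambda>j. s j - \<theta> j) {..<l} \<le> M / sqrt (real m)"
proof -
  obtain s where s: "s \<in> vertex_sums l M m" "(\<Sum>j<l. (s j - real m * \<theta> j)\<^sup>2) \<le> real m * M\<^sup>2"
    using vertex_sums_approx[OF assms(1,2)] by blast
  have "(\<Sum>j<l. (s j / real m - \<theta> j)\<^sup>2) = (\<Sum>j<l. (s j - real m * \<theta> j)\<^sup>2 / (real m)\<^sup>2)"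
    using assms(3) by (intro sum.cong) (auto simp: power_divide[symmetric] diff_divide_distrib)
  also have "\<dots> = (\<Sum>j<l. (s j - real m * \<theta> j)\<^sup>2) / (real m)\<^sup>2"
    by (simp add: sum_divide_distrib)
  also have "\<dots> \<le> real m * M\<^sup>2 / (real m)\<^sup>2"
    by (intro divide_right_mono s(2)) simp
  also have "\<dots> = M\<^sup>2 / real m"
    by (simp add: power2_eq_square)
  finally have "L2_set (\<lambda>j. s j / real m - \<theta> j) {..<l} \<le> sqrt (M\<^sup>2 / real m)"
    by (simp add: L2_set_def)
  also have "\<dots> = M / sqrt (real m)"
    using assms(2) by (simp add: real_sqrt_divide)
  finally have "L2_set (\<lambda>j. s j / real m - \<theta> j) {..<l} \<le> M / sqrt (real m)" .
  moreover have "(\<lambda>i. s i / real m) \<in> maurey_net l M m"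
    unfolding maurey_net_def using s(1) by (rule imageI)
  ultimately show ?thesis
    by (intro bexI[of _ "\<lambda>i. s i / real m"])
qed

section \<open>Chaining\<close>

text \<open>
  Since \<open>2 * l + 1 \<le> (l + 1)\<^sup>2\<close> and \<open>2 \<le> l + 1\<close>, the argument of the logarithm is at most
  \<open>(l + 1) ^ (2 * m + 1)\<close>.
\<close>

lemma sqrt_ln_net_size_le:
  assumes "l \<ge> 1" "2 * real m + 1 \<le> c\<^sup>2" "c \<ge> 0"
  shows "sqrt (ln (2 * real ((2 * l + 1) ^ m))) \<le> c * sqrt (ln (real l + 1))"
proof -
  have "2 * real ((2 * l + 1) ^ m) \<le> (real l + 1) * ((real l + 1)\<^sup>2) ^ m"
    using assms(1) by (simp, intro mult_mono power_mono) (auto simp: power2_eq_square algebra_simps)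
  also have "\<dots> = (real l + 1) ^ (2 * m + 1)"
    by (simp add: power_mult)
  finally have "ln (2 * real ((2 * l + 1) ^ m)) \<le> ln ((real l + 1) ^ (2 * m + 1))"
    by (intro ln_mono) auto
  also have "\<dots> = (2 * real m + 1) * ln (real l + 1)"
    by (subst ln_realpow) auto
  also have "\<dots> \<le> c\<^sup>2 * ln (real l + 1)"
    using assms by (intro mult_right_mono) auto
  finally have "sqrt (ln (2 * real ((2 * l + 1) ^ m))) \<le> sqrt (c\<^sup>2 * ln (real l + 1))"
    by simp
  then show ?thesis
    using assms(3) by (simp add: real_sqrt_mult)
qed

lemma half_le_ln_Suc: "1 / 2 \<le> ln (real k + 1)" if "k \<ge> 1"
proof -
  have "1 / 2 \<le> ln (2::real)"
    using ln2_ge_two_thirds by simp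
  also have "\<dots> \<le> ln (real k + 1)"
    using that by simp
  finally show ?thesis .
qed

text \<open>
  The chain may stop at depth \<open>L\<close>, where the scale \<open>M / 2 ^ L\<close> of the net is at most \<open>M / sqrt n\<close>.
\<close>

lemma dyadic_depth:
  assumes "n \<ge> 1"
  obtains L :: nat where "sqrt (real n) \<le> 2 ^ L" "real L \<le> 3 * ln (real n + 1)"
proof -
  define L where "L = nat \<lceil>log 4 (real n)\<rceil>"
  have log: "log 4 (real n) \<ge> 0"
    using assms by (simp add: zero_le_log_cancel_iff)
  have "real n = 4 powr log 4 (real n)"
    using assms by simp
  also have "\<dots> \<le> 4 powr real L"
    unfolding L_def using log by (intro powr_mono) linarith+
  also have "\<dots> = (2 ^ L)\<^sup>2"
    by (simp add: powr_realpow power_mult_distrib power2_eq_square flip: power_mult_distrib)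
  finally have "sqrt (real n) \<le> 2 ^ L"
    by (simp add: real_le_lsqrt)
  moreover have "real L \<le> 3 * ln (real n + 1)"
  proof -
    have "ln (4::real) \<ge> 1"
      using ln2_ge_two_thirds ln_realpow[of 2 2] by simp
    then have "log 4 (real n) \<le> ln (real n)"
      using assms by (simp add: log_def divide_le_eq mult_le_cancel_left1 ln_ge_zero)
    also have "\<dots> \<le> ln (real n + 1)"
      using assms by simp
    finally have "real L \<le> ln (real n + 1) + 1"
      unfolding L_def using log by linarith
    then show ?thesis
      using half_le_ln_Suc[OF assms] by linarith
  qed
  ultimately show ?thesis
    by (rule that)
qed

lemma rademacher_sum_diff:
  "rademacher_sum n \<phi> x \<theta> \<epsilon> - rademacher_sum n \<phi> x \<theta>' \<epsilon> = (\<Sum>i<n. \<epsilon> i * (\<phi> \<theta> (x i) - \<phi> \<theta>' (x i)))"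
  by (simp add: rademacher_sum_def algebra_simps sum_subtractf)

text \<open>
  This deterministic Cauchy--Schwarz bound closes the chain at its finest scale.
\<close>

lemma rademacher_sum_diff_le:
  assumes "\<epsilon> \<in> set_pmf (rademacher_pmf n)"
  shows "\<bar>rademacher_sum n \<phi> x \<theta> \<epsilon> - rademacher_sum n \<phi> x \<theta>' \<epsilon>\<bar> \<le> sqrt (real n) * param_dist n \<phi> x \<theta> \<theta>'"
proof -
  have \<epsilon>: "\<bar>\<epsilon> i\<bar> = 1" if "i < n" for i
    using assms that by (auto simp: set_rademacher_pmf PiE_dflt_def)
  have "\<bar>\<Sum>i<n. \<epsilon> i * (\<phi> \<theta> (x i) - \<phi> \<theta>' (x i))\<bar> \<le> (\<Sum>i<n. \<bar>\<epsilon> i\<bar> * \<bar>\<phi> \<theta> (x i) - \<phi> \<theta>' (x i)\<bar>)"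
    by (rule order.trans[OF sum_abs]) (simp add: abs_mult)
  also have "\<dots> \<le> L2_set \<epsilon> {..<n} * param_dist n \<phi> x \<theta> \<theta>'"
    unfolding param_dist_def by (rule L2_set_mult_ineq)
  also have "L2_set \<epsilon> {..<n} = sqrt (real n)"
    using \<epsilon> by (simp add: L2_set_def flip: abs_square_eq_1)
  finally show ?thesis
    by (simp add: rademacher_sum_diff)
qed

text \<open>
  Each \<open>\<theta>\<close> is joined to \<open>\<theta>0\<close> through its approximations \<open>\<pi> \<theta> L, \<dots>, \<pi> \<theta> 0\<close> in the nets.
  In units of \<open>sqrt (n * ln (l + 1)) * A x * M\<close> the root, from \<open>\<pi> \<theta> 0\<close> to \<open>\<theta>0\<close>, costs \<open>6\<close>,
  every link costs \<open>9\<close>, and the remainder beyond depth \<open>L\<close> costs \<open>2\<close>. As \<open>L \<le> 3 * ln (n + 1)\<close>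
  and \<open>1 \<le> 2 * ln (n + 1)\<close>, the total is at most \<open>(2 * 8 + 3 * 9) * ln (n + 1)\<close>, whence \<open>43\<close>.
\<close>

lemma rademacher_sup_bound_43: "rademacher_sup_bound 43 \<XX>"
  unfolding rademacher_sup_bound_def
proof (intro allI impI)
  fix n l :: nat and M :: real and \<phi> :: "(nat \<Rightarrow> real) \<Rightarrow> 'a \<Rightarrow> real"
    and x :: "nat \<Rightarrow> 'a" and A :: "(nat \<Rightarrow> 'a) \<Rightarrow> real" and \<theta>0 :: "nat \<Rightarrow> real"
  assume n: "1 \<le> n" and l: "1 \<le> l" and M: "0 \<le> M" and \<theta>0: "\<theta>0 \<in> l1_ball l M"
    and lip: "\<forall>\<theta>\<in>l1_ball l M. \<forall>\<theta>'\<in>l1_ball l M.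
        param_dist n \<phi> x \<theta> \<theta>' \<le> sqrt (real n) * A x * L2_set (\<lambda>j. \<theta> j - \<theta>' j) {..<l}"
  define \<Theta> where "\<Theta> = l1_ball l M"
  define X where "X = rademacher_sum n \<phi> x"
  define D where "D = sqrt (real n) * A x"
  define dist2 where "dist2 = (\<lambda>s t :: nat \<Rightarrow> real. L2_set (\<lambda>j. s j - t j) {..<l})"
  define \<E> where "\<E> = (measure_pmf.expectation (rademacher_pmf n) :: ((nat \<Rightarrow> real) \<Rightarrow> real) \<Rightarrow> real)"
  define s where "s = sqrt (ln (real l + 1))"
  define ln_n where "ln_n = ln (real n + 1)"
  have lip': "param_dist n \<phi> x t t' \<le> D * dist2 t t'" if "t \<in> \<Theta>" "t' \<in> \<Theta>" for t t'
    using lip that by (auto simp: \<Theta>_def D_def dist2_def)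
  have dist2_sym: "dist2 t t' = dist2 t' t" for t t'
    by (simp add: dist2_def L2_set_def power2_commute)
  have dist2_tri: "dist2 t t'' \<le> dist2 t t' + dist2 t' t''" for t t' t''
    using L2_set_triangle_ineq[of "\<lambda>j. t j - t' j" "\<lambda>j. t' j - t'' j" "{..<l}"]
    by (simp add: dist2_def)
  \<comment> \<open>If \<open>M > 0\<close>, two distinct points of the ball force \<open>A x \<ge> 0\<close>. If \<open>M = 0\<close>, then \<open>A x\<close> may be
      negative, so the sign is stated for the product.\<close>
  have DM: "D * M \<ge> 0"
  proof (cases "M = 0")
    case False
    define e :: "nat \<Rightarrow> real" where "e = (\<lambda>j. if j = 0 then M else 0)"
    have "(\<Sum>j<l. \<bar>e j\<bar>) = M" "(\<Sum>j<l. (e j)\<^sup>2) = M\<^sup>2"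
      using l M by (simp_all add: e_def if_distrib[of abs] if_distrib[of "\<lambda>z. z\<^sup>2"] cong: if_cong)
    then have "e \<in> \<Theta>" "(\<lambda>_. 0) \<in> \<Theta>" and *: "dist2 e (\<lambda>_. 0) = M"
      using l M by (auto simp: \<Theta>_def mem_l1_ball dist2_def L2_set_def e_def)
    have "0 \<le> param_dist n \<phi> x e (\<lambda>_. 0)"
      by (simp add: param_dist_def)
    also have "\<dots> \<le> D * M"
      using lip'[OF \<open>e \<in> \<Theta>\<close> \<open>(\<lambda>_. 0) \<in> \<Theta>\<close>] by (simp add: *)
    finally show ?thesis .
  qed simp
  \<comment> \<open>Since the sign of \<open>D\<close> alone is unknown, radii are given as multiples of \<open>M\<close>.\<close>
  have lipM: "param_dist n \<phi> x t t' \<le> D * M * r"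
    if "t \<in> \<Theta>" "t' \<in> \<Theta>" "dist2 t t' \<le> r * M" for t t' r
  proof (cases "M = 0")
    case True
    then have "dist2 t t' = 0"
      using that(3) L2_set_nonneg[of "\<lambda>j. t j - t' j" "{..<l}"] by (simp add: dist2_def)
    then show ?thesis
      using lip'[OF that(1,2)] True by simp
  next
    case False
    then have "D \<ge> 0"
      using DM M by (simp add: zero_le_mult_iff)
    then have "D * dist2 t t' \<le> D * (r * M)"
      using that(3) by (intro mult_left_mono)
    then show ?thesis
      using lip'[OF that(1,2)] by (simp add: mult_ac)
  qed
  have s: "s \<ge> 1 / 2"
    unfolding s_def using half_le_ln_Suc[OF l] by (intro real_le_rsqrt) (simp add: power2_eq_square)
  have ln_n: "ln_n \<ge> 1 / 2"
    unfolding ln_n_def by (rule half_le_ln_Suc[OF n])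

  have max_le: "\<E> (\<lambda>\<epsilon>. MAX p\<in>P. \<bar>X (fst p) \<epsilon> - X (snd p) \<epsilon>\<bar>) \<le> 3 / 2 * (D * M * r) * (c * s)"
    if P: "finite P" "P \<noteq> {}" "card P \<le> (2 * l + 1) ^ m" "P \<subseteq> \<Theta> \<times> \<Theta>"
      and r: "\<And>p. p \<in> P \<Longrightarrow> dist2 (fst p) (snd p) \<le> r * M" "r \<ge> 0"
      and c: "2 * real m + 1 \<le> c\<^sup>2" "c \<ge> 0" for P m r c
  proof -
    have "L2_set (\<lambda>i. \<phi> (fst p) (x i) - \<phi> (snd p) (x i)) {..<n} \<le> D * M * r" if "p \<in> P" for p
      using lipM[OF _ _ r(1)[OF that]] that P(4) by (auto simp: param_dist_def)
    from expectation_Max_le[OF P(1,2,3) this]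
    have "\<E> (\<lambda>\<epsilon>. MAX p\<in>P. \<bar>X (fst p) \<epsilon> - X (snd p) \<epsilon>\<bar>)
        \<le> 3 / 2 * (D * M * r) * sqrt (ln (2 * real ((2 * l + 1) ^ m)))"
      by (simp add: \<E>_def X_def rademacher_sum_diff)
    also have "\<dots> \<le> 3 / 2 * (D * M * r) * (c * s)"
      unfolding s_def using DM r(2) by (intro mult_left_mono sqrt_ln_net_size_le l c) auto
    finally show ?thesis .
  qed

  define T where "T = (\<lambda>k. maurey_net l M (4 ^ k))"
  have T: "T k \<subseteq> \<Theta>" "finite (T k)" "card (T k) \<le> (2 * l + 1) ^ (4 ^ k)" for k
    unfolding T_def \<Theta>_def using maurey_net_subset_l1_ball[OF M, of "4 ^ k"] card_maurey_net by auto
  have "\<forall>\<theta>\<in>\<Theta>. \<forall>k. \<exists>t. t \<in> T k \<and> dist2 t \<theta> \<le> M / 2 ^ k"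
  proof (intro ballI allI)
    fix \<theta> k assume "\<theta> \<in> \<Theta>"
    have "sqrt (real (4 ^ k)) = (2::real) ^ k"
      by (simp add: real_sqrt_power)
    then show "\<exists>t. t \<in> T k \<and> dist2 t \<theta> \<le> M / 2 ^ k"
      using maurey_net_approx[of \<theta> l M "4 ^ k"] \<open>\<theta> \<in> \<Theta>\<close> M
      unfolding \<Theta>_def T_def dist2_def by auto
  qed
  then obtain \<pi> where \<pi>: "\<And>\<theta> k. \<theta> \<in> \<Theta> \<Longrightarrow> \<pi> \<theta> k \<in> T k"
    "\<And>\<theta> k. \<theta> \<in> \<Theta> \<Longrightarrow> dist2 (\<pi> \<theta> k) \<theta> \<le> M / 2 ^ k"
    by metis
  have \<pi>_mem: "\<pi> \<theta> k \<in> \<Theta>" if "\<theta> \<in> \<Theta>" for \<theta> k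
    using \<pi>(1)[OF that] T(1) by blast
  have \<theta>0_mem: "\<theta>0 \<in> \<Theta>"
    using \<theta>0 by (simp add: \<Theta>_def)

  \<comment> \<open>Only the pairs that occur in a chain are collected: the other pairs of net points may be too
      far apart for the bound on the increments.\<close>
  define root where "root = (\<lambda>\<theta>. (\<pi> \<theta> 0, \<theta>0)) ` \<Theta>"
  define link where "link = (\<lambda>k. (\<lambda>\<theta>. (\<pi> \<theta> (Suc k), \<pi> \<theta> k)) ` \<Theta>)"
  have root_sub: "root \<subseteq> T 0 \<times> {\<theta>0}" and link_sub: "link k \<subseteq> T (Suc k) \<times> T k" for k
    using \<pi>(1) by (auto simp: root_def link_def)
  have root_fin: "finite root" and link_fin: "finite (link k)" for k
    using finite_subset[OF root_sub] finite_subset[OF link_sub] T(2) by auto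
  have root_le: "\<E> (\<lambda>\<epsilon>. MAX p\<in>root. \<bar>X (fst p) \<epsilon> - X (snd p) \<epsilon>\<bar>) \<le> 6 * (D * M * s)"
  proof -
    have "card root \<le> card (T 0 \<times> {\<theta>0})"
      using T(2) by (intro card_mono root_sub) auto
    also have "\<dots> \<le> (2 * l + 1) ^ 1"
      using T(3)[of 0] by (simp add: card_cartesian_product)
    finally have "card root \<le> (2 * l + 1) ^ 1" .
    moreover have "dist2 (fst p) (snd p) \<le> 2 * M" if p: "p \<in> root" for p
    proof -
      have small: "dist2 t (\<lambda>_. 0) \<le> M" if "t \<in> \<Theta>" for t
        using that L2_set_le_sum_abs[of t "{..<l}"] by (auto simp: dist2_def \<Theta>_def mem_l1_ball)
      have "fst p \<in> \<Theta>" "snd p \<in> \<Theta>"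
        using p \<pi>_mem \<theta>0_mem by (auto simp: root_def)
      from small[OF this(1)] small[OF this(2)] show ?thesis
        using dist2_tri[of "fst p" "snd p" "\<lambda>_. 0"] dist2_sym[of "snd p" "\<lambda>_. 0"] by simp
    qed
    ultimately show ?thesis
      using max_le[of root 1 2 2] root_fin \<theta>0_mem \<pi>_mem by (force simp: root_def)
  qed
  have link_le: "\<E> (\<lambda>\<epsilon>. MAX p\<in>link k. \<bar>X (fst p) \<epsilon> - X (snd p) \<epsilon>\<bar>) \<le> 9 * (D * M * s)" for k
  proof -
    have "card (link k) \<le> card (T (Suc k) \<times> T k)"
      using T(2) by (intro card_mono link_sub) auto
    also have "\<dots> \<le> (2 * l + 1) ^ (4 ^ Suc k) * (2 * l + 1) ^ (4 ^ k)"
      unfolding card_cartesian_product by (intro mult_mono T(3)) auto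
    also have "\<dots> = (2 * l + 1) ^ (5 * 4 ^ k)"
      by (simp flip: power_add)
    finally have card: "card (link k) \<le> (2 * l + 1) ^ (5 * 4 ^ k)" .
    have dist: "dist2 (fst p) (snd p) \<le> 3 / 2 / 2 ^ k * M" if p: "p \<in> link k" for p
    proof -
      obtain \<theta> where \<theta>: "\<theta> \<in> \<Theta>" "p = (\<pi> \<theta> (Suc k), \<pi> \<theta> k)"
        using p by (auto simp: link_def)
      have "dist2 (\<pi> \<theta> (Suc k)) (\<pi> \<theta> k) \<le> M / 2 ^ Suc k + M / 2 ^ k"
        using dist2_tri[of "\<pi> \<theta> (Suc k)" "\<pi> \<theta> k" \<theta>] dist2_sym[of \<theta> "\<pi> \<theta> k"]
          \<pi>(2)[OF \<theta>(1), of k] \<pi>(2)[OF \<theta>(1), of "Suc k"] by linarith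
      also have "\<dots> = 3 / 2 / 2 ^ k * M"
        by (simp add: field_simps)
      finally show ?thesis
        by (simp add: \<theta>(2))
    qed
    have size: "2 * real (5 * 4 ^ k) + 1 \<le> (4 * 2 ^ k)\<^sup>2"
    proof -
      have one: "(1::real) \<le> 4 ^ k"
        by simp
      have "2 * real (5 * 4 ^ k) + 1 = 10 * 4 ^ k + 1"
        by simp
      also have "\<dots> \<le> 16 * 4 ^ k"
        using one by linarith
      also have "\<dots> = (4 * 2 ^ k)\<^sup>2"
        by (simp add: power2_eq_square flip: power_mult_distrib)
      finally show ?thesis .
    qed
    have "\<E> (\<lambda>\<epsilon>. MAX p\<in>link k. \<bar>X (fst p) \<epsilon> - X (snd p) \<epsilon>\<bar>)
        \<le> 3 / 2 * (D * M * (3 / 2 / 2 ^ k)) * (4 * 2 ^ k * s)"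
      using \<theta>0_mem \<pi>_mem by (intro max_le[OF link_fin _ card _ dist _ size]) (auto simp: link_def)
    also have "\<dots> = 9 * (D * M * s)"
      by (simp add: field_simps)
    finally show ?thesis .
  qed

  obtain L where L: "sqrt (real n) \<le> 2 ^ L" "real L \<le> 3 * ln_n"
    using dyadic_depth[OF n] unfolding ln_n_def by blast
  have le_Max: "\<bar>X t \<epsilon> - X t' \<epsilon>\<bar> \<le> (MAX p\<in>P. \<bar>X (fst p) \<epsilon> - X (snd p) \<epsilon>\<bar>)"
    if "finite P" "(t, t') \<in> P" for P t t' \<epsilon>
    using that by (intro Max_ge image_eqI[of _ _ "(t, t')"]) auto
  have pointwise: "(SUP \<theta>\<in>\<Theta>. \<bar>X \<theta> \<epsilon>\<bar>) \<le> \<bar>X \<theta>0 \<epsilon>\<bar> + (MAX p\<in>root. \<bar>X (fst p) \<epsilon> - X (snd p) \<epsilon>\<bar>)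
      + (\<Sum>k<L. MAX p\<in>link k. \<bar>X (fst p) \<epsilon> - X (snd p) \<epsilon>\<bar>) + D * M"
    if \<epsilon>: "\<epsilon> \<in> set_pmf (rademacher_pmf n)" for \<epsilon>
  proof (rule cSUP_least)
    show "\<Theta> \<noteq> {}"
      using \<theta>0_mem by blast
    fix \<theta> assume \<theta>: "\<theta> \<in> \<Theta>"
    have "X \<theta> \<epsilon> = X \<theta>0 \<epsilon> + (X (\<pi> \<theta> 0) \<epsilon> - X \<theta>0 \<epsilon>)
        + (\<Sum>k<L. X (\<pi> \<theta> (Suc k)) \<epsilon> - X (\<pi> \<theta> k) \<epsilon>) + (X \<theta> \<epsilon> - X (\<pi> \<theta> L) \<epsilon>)"
      using sum_lessThan_telescope[of "\<lambda>k. X (\<pi> \<theta> k) \<epsilon>" L] by simp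
    then have "\<bar>X \<theta> \<epsilon>\<bar> \<le> \<bar>X \<theta>0 \<epsilon>\<bar> + \<bar>X (\<pi> \<theta> 0) \<epsilon> - X \<theta>0 \<epsilon>\<bar>
        + (\<Sum>k<L. \<bar>X (\<pi> \<theta> (Suc k)) \<epsilon> - X (\<pi> \<theta> k) \<epsilon>\<bar>) + \<bar>X \<theta> \<epsilon> - X (\<pi> \<theta> L) \<epsilon>\<bar>"
      using sum_abs[of "\<lambda>k. X (\<pi> \<theta> (Suc k)) \<epsilon> - X (\<pi> \<theta> k) \<epsilon>" "{..<L}"] by linarith
    also have "\<bar>X (\<pi> \<theta> 0) \<epsilon> - X \<theta>0 \<epsilon>\<bar> \<le> (MAX p\<in>root. \<bar>X (fst p) \<epsilon> - X (snd p) \<epsilon>\<bar>)"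
      using root_fin \<theta> by (intro le_Max) (auto simp: root_def)
    also have "(\<Sum>k<L. \<bar>X (\<pi> \<theta> (Suc k)) \<epsilon> - X (\<pi> \<theta> k) \<epsilon>\<bar>)
        \<le> (\<Sum>k<L. MAX p\<in>link k. \<bar>X (fst p) \<epsilon> - X (snd p) \<epsilon>\<bar>)"
      using link_fin \<theta> by (intro sum_mono le_Max) (auto simp: link_def)
    also have "\<bar>X \<theta> \<epsilon> - X (\<pi> \<theta> L) \<epsilon>\<bar> \<le> D * M"
    proof -
      have "dist2 \<theta> (\<pi> \<theta> L) \<le> 1 / 2 ^ L * M"
        using \<pi>(2)[OF \<theta>] dist2_sym by simp
      then have "param_dist n \<phi> x \<theta> (\<pi> \<theta> L) \<le> D * M * (1 / 2 ^ L)"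
        by (intro lipM \<theta> \<pi>_mem)
      then have "\<bar>X \<theta> \<epsilon> - X (\<pi> \<theta> L) \<epsilon>\<bar> \<le> 2 ^ L * (D * M * (1 / 2 ^ L))"
        unfolding X_def using L(1)
        by (intro order.trans[OF rademacher_sum_diff_le[OF \<epsilon>]] mult_mono)
          (auto simp: param_dist_def)
      then show ?thesis
        by simp
    qed
    finally show "\<bar>X \<theta> \<epsilon>\<bar> \<le> \<bar>X \<theta>0 \<epsilon>\<bar> + (MAX p\<in>root. \<bar>X (fst p) \<epsilon> - X (snd p) \<epsilon>\<bar>)
      + (\<Sum>k<L. MAX p\<in>link k. \<bar>X (fst p) \<epsilon> - X (snd p) \<epsilon>\<bar>) + D * M"
      by simp
  qed
  have "\<E> (\<lambda>\<epsilon>. SUP \<theta>\<in>\<Theta>. \<bar>X \<theta> \<epsilon>\<bar>) \<le> \<E> (\<lambda>\<epsilon>. \<bar>X \<theta>0 \<epsilon>\<bar>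
      + (MAX p\<in>root. \<bar>X (fst p) \<epsilon> - X (snd p) \<epsilon>\<bar>)
      + (\<Sum>k<L. MAX p\<in>link k. \<bar>X (fst p) \<epsilon> - X (snd p) \<epsilon>\<bar>) + D * M)"
    unfolding \<E>_def using pointwise by (intro integral_mono_AE AE_pmfI) auto
  also have "\<dots> = \<E> (\<lambda>\<epsilon>. \<bar>X \<theta>0 \<epsilon>\<bar>)
      + \<E> (\<lambda>\<epsilon>. MAX p\<in>root. \<bar>X (fst p) \<epsilon> - X (snd p) \<epsilon>\<bar>)
      + (\<Sum>k<L. \<E> (\<lambda>\<epsilon>. MAX p\<in>link k. \<bar>X (fst p) \<epsilon> - X (snd p) \<epsilon>\<bar>)) + D * M"
    unfolding \<E>_def by (simp add: Bochner_Integration.integral_add Bochner_Integration.integral_sum)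
  also have "\<dots> \<le> \<E> (\<lambda>\<epsilon>. \<bar>X \<theta>0 \<epsilon>\<bar>) + 6 * (D * M * s) + (\<Sum>k<L. 9 * (D * M * s)) + D * M * (2 * s)"
    using s DM by (intro add_mono root_le sum_mono link_le order.refl) (simp add: mult_le_cancel_left1)
  also have "\<dots> = \<E> (\<lambda>\<epsilon>. \<bar>X \<theta>0 \<epsilon>\<bar>) + D * M * s * (8 + 9 * real L)"
    by (simp add: algebra_simps)
  also have "\<dots> \<le> \<E> (\<lambda>\<epsilon>. \<bar>X \<theta>0 \<epsilon>\<bar>) + D * M * s * (43 * ln_n)"
    using DM s L(2) ln_n by (intro add_left_mono mult_left_mono) auto
  also have "D * M * s * (43 * ln_n) = 43 * sqrt (real n * ln (real l + 1)) * ln (real n + 1) * A x * M"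
    by (simp add: D_def s_def ln_n_def real_sqrt_mult)
  finally show "measure_pmf.expectation (rademacher_pmf n)
          (\<lambda>\<epsilon>. SUP \<theta>\<in>l1_ball l M. \<bar>rademacher_sum n \<phi> x \<theta> \<epsilon>\<bar>)
        \<le> measure_pmf.expectation (rademacher_pmf n) (\<lambda>\<epsilon>. \<bar>rademacher_sum n \<phi> x \<theta>0 \<epsilon>\<bar>)
          + 43 * sqrt (real n * ln (real l + 1)) * ln (real n + 1) * A x * M"
    by (simp add: \<E>_def X_def \<Theta>_def)
qed

theorem theorem1p1:
  fixes n l :: nat and M :: real and \<XX> :: "'a set"
    and \<phi> :: "(nat \<Rightarrow> real) \<Rightarrow> 'a \<Rightarrow> real" and x :: "nat \<Rightarrow> 'a"
    and A :: "(nat \<Rightarrow> 'a) \<Rightarrow> real" and \<theta>0 :: "nat \<Rightarrow> real"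
  assumes "1 \<le> n" and "1 \<le> l" and "0 \<le> M"
    and "x \<in> {..<n} \<rightarrow>\<^sub>E \<XX>"
    and "\<forall>\<theta>\<in>l1_ball l M. \<forall>\<theta>'\<in>l1_ball l M.
      param_dist n \<phi> x \<theta> \<theta>' \<le> sqrt (real n) * A x * L2_set (\<lambda>j. \<theta> j - \<theta>' j) {..<l}"
    and "\<theta>0 \<in> l1_ball l M"
  shows "measure_pmf.expectation (rademacher_pmf n)
      (\<lambda>\<epsilon>. SUP \<theta>\<in>l1_ball l M. \<bar>rademacher_sum n \<phi> x \<theta> \<epsilon>\<bar>)
    \<le> measure_pmf.expectation (rademacher_pmf n) (\<lambda>\<epsilon>. \<bar>rademacher_sum n \<phi> x \<theta>0 \<epsilon>\<bar>)
      + universal_K * sqrt (real n * ln (real l + 1)) * ln (real n + 1) * A x * M"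
proof -
  \<comment> \<open>Since \<open>43\<close> has the defining property of \<open>universal_K\<close>, so does the chosen constant, whatever
      its value.\<close>
  have "\<forall>\<YY> :: nat set. rademacher_sup_bound universal_K \<YY>"
    unfolding universal_K_def by (rule someI[of _ 43]) (simp add: rademacher_sup_bound_43)
  then have "rademacher_sup_bound universal_K \<XX>"
    by (rule rademacher_sup_bound_transfer)
  with assms show ?thesis
    unfolding rademacher_sup_bound_def by blast
qed

end
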